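(* For any $w,b\in\mathbb{N}$, $$T(w,b) = \frac{w+b}{2(w+b-1)} \sum_{i=0}^{\min\{w,b\}-1}\ \sum_{j=i}^{w+b-2-i}\frac{\binom{w+b-1}{i}}{\binom{w+b-2}{j}}.$$ In particular, for any $k\in\mathbb{N}$, $$T(k,k) = k \sum_{i=0}^{k-1} \frac{1}{2i+1}.$$
   Context: Mabinogion urn model (M-process): an urn contains white and black balls. At each time $1,2,3,\dots$ one ball is drawn uniformly at random from the urn, independently of previous selections, its color is observed and it is returned. If the drawn ball is white, one black ball is replaced by a white one; if the drawn ball is black, one white ball is replaced by a black one. The process stops when all balls are of the same color. Let $W_n,B_n$ be the numbers of white and black balls after $n$ transitions; thus $(W_n,B_n)$ is a Markov chain which, from a state $(w,b)$ with $w,b>0$, moves to $(w+1,b-1)$ with probability $\frac{w}{w+b}$ and to $(w-1,b+1)$ with probability $\frac{b}{w+b}$; states with $w=0$ or $b=0$ are absorbing. Let $H:=\min\{n: W_n=0 \text{ or } B_n=0\}$ and let $T(w,b):=\mathbf{E}(H\mid W_0=w,B_0=b)$ be the expected time to absorption. Here $\mathbb{N}=\{1,2,3,\dots\}$. *)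

theory Defs
  imports "HOL-Probability.Probability"
begin

text \<open>
  Time-homogeneous Markov chains on a countable state space with transition kernel \<open>K\<close>, realised
  on an arbitrary probability space \<open>M\<close>; the law of the initial state is not prescribed.
\<close>

definition markov_chain ::
  "'a measure \<Rightarrow> ('s::countable \<Rightarrow> 's pmf) \<Rightarrow> (nat \<Rightarrow> 'a \<Rightarrow> 's) \<Rightarrow> bool"
where
  "markov_chain M K X \<longleftrightarrow>
     prob_space M \<and>
     (\<forall>n. X n \<in> measurable M (count_space UNIV)) \<and>
     (\<forall>n x y. \<P>(\<omega> in M. \<forall>i\<le>n. X i \<omega> = x i) > 0 \<longrightarrow>
        \<P>(\<omega> in M. X (Suc n) \<omega> = y \<bar> \<forall>i\<le>n. X i \<omega> = x i) = pmf (K (x n)) y)"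

text \<open>Such chains exist: take independent choices \<open>\<omega> (n, s)\<close> with law \<open>K s\<close> and follow them.\<close>

fun canonical_chain :: "'s \<Rightarrow> nat \<Rightarrow> (nat \<times> 's \<Rightarrow> 's) \<Rightarrow> 's" where
  "canonical_chain s 0 \<omega> = s"
| "canonical_chain s (Suc n) \<omega> = \<omega> (n, canonical_chain s n \<omega>)"

lemma canonical_chain_history:
  "(\<forall>i\<le>n. canonical_chain s i \<omega> = x i) \<longleftrightarrow> x 0 = s \<and> (\<forall>i<n. \<omega> (i, x i) = x (Suc i))"
proof (induction n)
  case 0
  then show ?case by auto
next
  case (Suc n)
  have "(\<forall>i\<le>Suc n. canonical_chain s i \<omega> = x i) \<longleftrightarrow>
      (\<forall>i\<le>n. canonical_chain s i \<omega> = x i) \<and> \<omega> (n, canonical_chain s n \<omega>) = x (Suc n)"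
    by (auto simp: le_Suc_eq)
  also have "\<dots> \<longleftrightarrow> (\<forall>i\<le>n. canonical_chain s i \<omega> = x i) \<and> \<omega> (n, x n) = x (Suc n)"
    by auto
  also have "\<dots> \<longleftrightarrow> x 0 = s \<and> (\<forall>i<Suc n. \<omega> (i, x i) = x (Suc i))"
    unfolding Suc.IH by (auto simp: less_Suc_eq)
  finally show ?case .
qed

lemma markov_chain_canonical_chain:
  fixes K :: "'s::countable \<Rightarrow> 's pmf"
  shows "markov_chain (PiM UNIV (\<lambda>(n, s). measure_pmf (K s))) K (canonical_chain s)"
proof -
  define N where "N = (\<lambda>(n::nat, s). measure_pmf (K s))"
  define M where "M = PiM UNIV N"
  interpret N: product_prob_space N UNIV
    by (rule product_prob_spaceI) (simp add: N_def split_def measure_pmf.prob_space_axioms)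
  interpret M: prob_space M
    unfolding M_def by (rule prob_space_PiM) (rule N.prob_space)
  have space_M: "space M = UNIV"
    by (auto simp: M_def N_def space_PiM PiE_def extensional_def split: prod.splits)
  have comp: "(\<lambda>\<omega>. \<omega> p) \<in> measurable M (count_space UNIV)" for p
  proof -
    have "(\<lambda>\<omega>. \<omega> p) \<in> measurable M (N p)"
      unfolding M_def by (rule measurable_component_singleton) simp
    moreover have "measurable M (N p) = measurable M (count_space UNIV)"
      by (rule measurable_cong_sets) (auto simp: N_def split: prod.splits)
    ultimately show ?thesis by simp
  qed
  have meas: "canonical_chain s n \<in> measurable M (count_space UNIV)" for n
  proof (induction n)
    case 0
    have "canonical_chain s 0 = (\<lambda>_. s)" by auto
    then show ?case by simp
  next
    case (Suc n)
    have "(\<lambda>\<omega>. (\<lambda>t \<omega>. \<omega> (n, t)) (canonical_chain s n \<omega>) \<omega>) \<in> measurable M (count_space UNIV)"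
      by (rule measurable_compose_countable[OF comp Suc])
    then show ?case by (simp add: fun_eq_iff[symmetric] cong: measurable_cong)
  qed
  have cyl: "\<P>(\<omega> in M. \<forall>i\<le>n. canonical_chain s i \<omega> = x i) =
      (if x 0 = s then \<Prod>i<n. pmf (K (x i)) (x (Suc i)) else 0)" for n x
  proof (cases "x 0 = s")
    case True
    define J where "J = (\<lambda>i. (i, x i)) ` {..<n}"
    have "{\<omega> \<in> space M. \<forall>i\<le>n. canonical_chain s i \<omega> = x i} =
        {\<omega> \<in> space M. \<forall>p\<in>J. \<omega> p \<in> {x (Suc (fst p))}}"
      using True unfolding canonical_chain_history J_def by auto
    also have "M.prob \<dots> = (\<Prod>p\<in>J. measure (N p) {x (Suc (fst p))})"
    proof (rule measure_eq_emeasure_eq_ennreal)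
      show "emeasure M {\<omega> \<in> space M. \<forall>p\<in>J. \<omega> p \<in> {x (Suc (fst p))}} =
          ennreal (\<Prod>p\<in>J. measure (N p) {x (Suc (fst p))})"
        unfolding M_def
        by (subst N.emeasure_PiM_Collect)
           (auto simp: J_def N.M.emeasure_eq_measure prod_ennreal, auto simp: N_def)
    qed (simp add: prod_nonneg)
    also have "\<dots> = (\<Prod>i<n. pmf (K (x i)) (x (Suc i)))"
      unfolding J_def by (subst prod.reindex) (auto simp: inj_on_def N_def pmf.rep_eq)
    finally show ?thesis using True by simp
  next
    case False
    then show ?thesis unfolding canonical_chain_history by simp
  qed
  have "\<P>(\<omega> in M. canonical_chain s (Suc n) \<omega> = y \<bar> \<forall>i\<le>n. canonical_chain s i \<omega> = x i)
      = pmf (K (x n)) y"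
    if pos: "\<P>(\<omega> in M. \<forall>i\<le>n. canonical_chain s i \<omega> = x i) > 0" for n x y
  proof -
    define x' where "x' = x(Suc n := y)"
    define c where "c = (\<Prod>i<n. pmf (K (x i)) (x (Suc i)))"
    have "x 0 = s"
      using pos unfolding cyl by (simp split: if_splits)
    then have den: "\<P>(\<omega> in M. \<forall>i\<le>n. canonical_chain s i \<omega> = x i) = c"
      unfolding cyl c_def by simp
    have "{\<omega> \<in> space M. canonical_chain s (Suc n) \<omega> = y \<and> (\<forall>i\<le>n. canonical_chain s i \<omega> = x i)} =
        {\<omega> \<in> space M. \<forall>i\<le>Suc n. canonical_chain s i \<omega> = x' i}"
      unfolding x'_def by (auto simp: le_Suc_eq simp del: canonical_chain.simps)
    moreover have "(\<Prod>i<n. pmf (K (x' i)) (x' (Suc i))) = c"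
      unfolding c_def by (rule prod.cong) (auto simp: x'_def)
    ultimately have
      "\<P>(\<omega> in M. canonical_chain s (Suc n) \<omega> = y \<and> (\<forall>i\<le>n. canonical_chain s i \<omega> = x i)) =
        c * pmf (K (x n)) y"
      using \<open>x 0 = s\<close> cyl[of "Suc n" x'] by (simp add: x'_def)
    then show ?thesis
      using pos unfolding cond_prob_def den by simp
  qed
  then show ?thesis
    using meas M.prob_space_axioms unfolding markov_chain_def M_def N_def by blast
qed

text \<open>States are pairs (number of white balls, number of black balls).\<close>

definition mabinogion_kernel :: "nat \<times> nat \<Rightarrow> (nat \<times> nat) pmf" where
  "mabinogion_kernel = (\<lambda>(w, b).
     if w = 0 \<or> b = 0 then return_pmf (w, b)
     else map_pmf (\<lambda>white. if white then (w + 1, b - 1) else (w - 1, b + 1))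
            (bernoulli_pmf (real w / real (w + b))))"

definition mabinogion :: "'a measure \<Rightarrow> (nat \<Rightarrow> 'a \<Rightarrow> nat) \<Rightarrow> (nat \<Rightarrow> 'a \<Rightarrow> nat) \<Rightarrow> bool" where
  "mabinogion M W B \<longleftrightarrow> markov_chain M mabinogion_kernel (\<lambda>n \<omega>. (W n \<omega>, B n \<omega>))"

text \<open>The infimum is \<open>\<infinity>\<close> on paths that are never absorbed.\<close>

definition absorption_time :: "(nat \<Rightarrow> 'a \<Rightarrow> nat) \<Rightarrow> (nat \<Rightarrow> 'a \<Rightarrow> nat) \<Rightarrow> 'a \<Rightarrow> enat" where
  "absorption_time W B \<omega> = (INF n\<in>{n. W n \<omega> = 0 \<or> B n \<omega> = 0}. enat n)"

text \<open>
  The expectation of the absorption time conditional on the event that the chain starts in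
  \<open>(w, b)\<close>, with values in \<open>[0, \<infinity>]\<close>; meaningful only if that event has positive probability.
\<close>

definition expected_absorption_time ::
  "'a measure \<Rightarrow> (nat \<Rightarrow> 'a \<Rightarrow> nat) \<Rightarrow> (nat \<Rightarrow> 'a \<Rightarrow> nat) \<Rightarrow> nat \<Rightarrow> nat \<Rightarrow> ennreal"
where
  "expected_absorption_time M W B w b =
     (\<integral>\<^sup>+\<omega>. ennreal_of_enat (absorption_time W B \<omega>)
        \<partial>uniform_measure M {\<omega> \<in> space M. W 0 \<omega> = w \<and> B 0 \<omega> = b})"

lemma mabinogion_exists:
  "\<exists>(M :: (nat \<times> (nat \<times> nat) \<Rightarrow> nat \<times> nat) measure) W B.
     mabinogion M W B \<and> \<P>(\<omega> in M. W 0 \<omega> = w \<and> B 0 \<omega> = b) = 1"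
proof -
  let ?M = "PiM UNIV (\<lambda>(n::nat, s). measure_pmf (mabinogion_kernel s))"
  let ?X = "canonical_chain (w, b)"
  have mc: "markov_chain ?M mabinogion_kernel ?X"
    by (rule markov_chain_canonical_chain)
  then interpret prob_space ?M by (simp add: markov_chain_def)
  show ?thesis
    using mc prob_space
    by (intro exI[of _ ?M] exI[of _ "\<lambda>n \<omega>. fst (?X n \<omega>)"] exI[of _ "\<lambda>n \<omega>. snd (?X n \<omega>)"])
       (simp add: mabinogion_def)
qed

end

theory Submission
  imports Defs
begin

text \<open>
  Let \<open>f\<close> be the claimed formula. On a line \<open>w + b = n + 2\<close> its increments are constant multiples
  of \<open>g i = (n + 1 choose i) * S i\<close>, where \<open>S i\<close> sums the inverses of \<open>n choose j\<close> over
  \<open>i \<le> j \<le> n - i\<close>. Since \<open>S i - S (i + 1) = 2 / (n choose i)\<close>, the increments satisfy the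
  first-order recursion equivalent to the one-step equation \<open>f x = 1 + E\<^sub>x f (X\<^sub>1)\<close>.
  Iterating this equation along the chain, killed on absorption, writes \<open>f x\<close> as the sum of
  \<open>P(H > k)\<close> over \<open>k < N\<close> plus a remainder at most a constant times \<open>P(H > N)\<close>. Hence the series of the
  \<open>P(H > k)\<close> converges, the remainder vanishes, and \<open>f x = E\<^sub>x H\<close>.

  For \<open>w = b\<close>, let \<open>A n m\<close> be the sum of \<open>g i\<close> over \<open>i < m\<close>. Pascal's rule and
  \<open>1 / (n choose j) + 1 / (n choose (j + 1)) = (n + 1) / n * (1 / (n - 1 choose j))\<close>
  relate \<open>A (n + 1)\<close> to \<open>A n\<close>, and two such steps add exactly one term \<open>1 / (2 * i + 1)\<close> to the
  normalised sum \<open>A (2 * m) (m + 1) / (2 * m + 1)\<close>.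
\<close>

section \<open>Sums of inverse binomial coefficients\<close>

definition inverse_binomial_sum :: "nat \<Rightarrow> nat \<Rightarrow> real" where
  "inverse_binomial_sum n i = (\<Sum>j = i..n - i. 1 / real (n choose j))"

lemma inverse_binomial_sum_eq_0:
  assumes "n < 2 * i" shows "inverse_binomial_sum n i = 0"
  using assms by (simp add: inverse_binomial_sum_def)

lemma inverse_binomial_sum_middle: "inverse_binomial_sum (2 * m) m = 1 / real ((2 * m) choose m)"
  by (simp add: inverse_binomial_sum_def mult_2)

text \<open>By symmetry the outer terms at \<open>j = i\<close> and \<open>j = n - i\<close> are
  equal; \<open>2 * i < n\<close> makes them distinct.\<close>

lemma inverse_binomial_sum_shift:
  assumes "2 * i < n"
  shows "inverse_binomial_sum n i = inverse_binomial_sum n (Suc i) + 2 / real (n choose i)"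
proof -
  have eq: "{i..n - i} = insert i (insert (n - i) {Suc i..n - Suc i})"
    using assms by auto
  have "n choose (n - i) = n choose i"
    using assms by (intro binomial_symmetric[symmetric]) simp
  then show ?thesis
    unfolding inverse_binomial_sum_def eq using assms by (subst sum.insert, auto)+
qed

text \<open>Over the common denominator \<open>(n + 1) * (n choose j)\<close> the fractions have
  numerators \<open>n + 1 - j\<close> and \<open>j + 1\<close>, which add up to
  \<open>n + 2\<close>.\<close>

lemma inverse_binomial_adjacent:
  assumes "j \<le> n"
  shows "1 / real (Suc n choose j) + 1 / real (Suc n choose Suc j)
    = (real n + 2) / (real n + 1) * (1 / real (n choose j))"
proof -
  have pos: "real (n choose j) > 0" "real (Suc n choose j) > 0" "real (Suc n choose Suc j) > 0"
    using assms by (simp_all del: binomial_Suc_Suc)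
  have "Suc j * (Suc n choose Suc j) = Suc n * (n choose j)"
    by (rule Suc_times_binomial)
  then have 1: "real (Suc j) * real (Suc n choose Suc j) = real (Suc n) * real (n choose j)"
    by (metis of_nat_mult)
  have "(Suc n - j) * (Suc n choose j) = Suc n * (n choose j)"
    using binomial_absorb_comp[of "Suc n" j] by simp
  then have 2: "real (Suc n - j) * real (Suc n choose j) = real (Suc n) * real (n choose j)"
    by (metis of_nat_mult)
  have 3: "1 / real (Suc n choose Suc j) = real (Suc j) / (real (Suc n) * real (n choose j))"
    using pos by (subst 1[symmetric]) (simp del: binomial_Suc_Suc)
  have 4: "1 / real (Suc n choose j) = real (Suc n - j) / (real (Suc n) * real (n choose j))"
    using pos assms by (subst 2[symmetric]) (simp del: binomial_Suc_Suc)
  have "real (Suc n - j) + real (Suc j) = real n + 2" using assms by (simp add: of_nat_diff)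
  then show ?thesis
    unfolding 3 4 add_divide_distrib[symmetric] by (simp add: add.commute)
qed

text \<open>Summing \<open>inverse_binomial_adjacent\<close> over
  \<open>i \<le> j \<le> n - i\<close> counts each term of row \<open>n + 1\<close> twice, except
  the two equal outer ones, which are counted once.\<close>

lemma inverse_binomial_sum_Suc:
  assumes "2 * i \<le> Suc n"
  shows "inverse_binomial_sum (Suc n) i
    = 1 / real (Suc n choose i) + (real n + 2) / (2 * (real n + 1)) * inverse_binomial_sum n i"
proof (cases "2 * i = Suc n")
  \<comment> \<open>Here the sum over row \<open>n\<close> is empty and the one over row
    \<open>n + 1\<close> consists of its middle term.\<close>
  case True
  then have "Suc n - i = i" by linarith
  then show ?thesis
    using inverse_binomial_sum_eq_0[of n i] True by (simp add: inverse_binomial_sum_def)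
next
  case False
  define c where "c j = 1 / real (Suc n choose j)" for j
  have le: "2 * i \<le> n" using assms False by simp
  have eq: "Suc n - i = Suc (n - i)" using le by simp
  have sym: "c (Suc (n - i)) = c i"
    unfolding c_def using binomial_symmetric[of i "Suc n"] le eq by simp
  have "(real n + 2) / (real n + 1) * inverse_binomial_sum n i = (\<Sum>j = i..n - i. c j + c (Suc j))"
    unfolding inverse_binomial_sum_def sum_distrib_left c_def
    by (rule sum.cong) (auto simp only: inverse_binomial_adjacent atLeastAtMost_iff)
  also have "\<dots> = (\<Sum>j = i..n - i. c j) + (\<Sum>j = Suc i..Suc (n - i). c j)"
    by (simp only: sum.distrib sum.atLeast_Suc_atMost_Suc_shift comp_def)
  also have "(\<Sum>j = i..n - i. c j) = inverse_binomial_sum (Suc n) i - c i"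
    unfolding inverse_binomial_sum_def eq c_def[symmetric] using le sym by simp
  also have "(\<Sum>j = Suc i..Suc (n - i). c j) = inverse_binomial_sum (Suc n) i - c i"
    unfolding inverse_binomial_sum_def eq c_def[symmetric]
    using le by (subst sum.atLeast_Suc_atMost[of i "Suc (n - i)" c]) auto
  finally show ?thesis unfolding c_def by (simp add: field_simps)
qed

text \<open>Both \<open>Suc i * (Suc n choose Suc i)\<close> and
  \<open>(n + 1 - i) * (Suc n choose i)\<close> equal \<open>(n + 1) * (n choose i)\<close>, so
  \<open>inverse_binomial_sum_shift\<close> gives the claim.\<close>

lemma choose_mult_inverse_binomial_sum_step:
  assumes "2 * i < n"
  shows "real (Suc i) * (real (Suc n choose Suc i) * inverse_binomial_sum n (Suc i))
    = (real n + 1 - real i) * (real (Suc n choose i) * inverse_binomial_sum n i) - 2 * (real n + 1)"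
proof -
  have pos: "real (n choose i) > 0" using assms by simp
  have 1: "real (Suc i) * real (Suc n choose Suc i) = (real n + 1) * real (n choose i)"
    using arg_cong[OF Suc_times_binomial[of i n], of real]
    by (simp add: algebra_simps del: binomial_Suc_Suc)
  have "(Suc n - i) * (Suc n choose i) = Suc n * (n choose i)"
    using binomial_absorb_comp[of "Suc n" i] by simp
  then have "real (Suc n - i) * real (Suc n choose i) = (real n + 1) * real (n choose i)"
    by (metis of_nat_Suc of_nat_mult add.commute)
  then have 2: "(real n + 1 - real i) * real (Suc n choose i) = (real n + 1) * real (n choose i)"
    using assms by (simp add: of_nat_diff algebra_simps)
  show ?thesis
    unfolding mult.assoc[symmetric] 1 2 inverse_binomial_sum_shift[OF assms]
    using pos by (simp add: field_simps)
qed

lemma Suc_choose_over_choose: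
  assumes "i \<le> n"
  shows "real (Suc n choose i) / real (n choose i) = (real n + 1) / (real n + 1 - real i)"
proof -
  have "(Suc n - i) * (Suc n choose i) = Suc n * (n choose i)"
    using binomial_absorb_comp[of "Suc n" i] by simp
  then have "real (Suc n - i) * real (Suc n choose i) = (real n + 1) * real (n choose i)"
    by (metis of_nat_Suc of_nat_mult add.commute)
  then show ?thesis using assms by (simp add: of_nat_diff field_simps)
qed

text \<open>For the urn, \<open>n\<close> is the number of balls minus 2 and \<open>m\<close> the
  size of the minority colour.\<close>

definition mabinogion_sum :: "nat \<Rightarrow> nat \<Rightarrow> real" where
  "mabinogion_sum n m = (\<Sum>i<m. real (Suc n choose i) * inverse_binomial_sum n i)"

lemma mabinogion_sum_Suc_arg:
  "mabinogion_sum n (Suc m) = mabinogion_sum n m + real (Suc n choose m) * inverse_binomial_sum n m"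
  by (simp add: mabinogion_sum_def)

section \<open>The formula for the absorption time\<close>

definition mabinogion_time :: "nat \<times> nat \<Rightarrow> real" where
  "mabinogion_time = (\<lambda>(w, b). real (w + b) / (2 * (real (w + b) - 1)) *
     mabinogion_sum (w + b - 2) (min w b))"

lemma mabinogion_time_alt:
  assumes "w + b = n + 2"
  shows "mabinogion_time (w, b) = (real n + 2) / (2 * (real n + 1)) * mabinogion_sum n (min w b)"
  using assms by (simp add: mabinogion_time_def algebra_simps flip: of_nat_add)

lemma mabinogion_time_swap: "mabinogion_time (w, b) = mabinogion_time (b, w)"
  by (simp add: mabinogion_time_def add.commute min.commute)

lemma mabinogion_time_nonneg: "mabinogion_time x \<ge> 0"
proof (cases x)
  case (Pair w b)
  then show ?thesis
    by (cases "w + b = 0")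
       (auto simp: mabinogion_time_def mabinogion_sum_def inverse_binomial_sum_def
         intro!: mult_nonneg_nonneg sum_nonneg divide_nonneg_nonneg)
qed

lemma mabinogion_time_eq_0: "w = 0 \<or> b = 0 \<Longrightarrow> mabinogion_time (w, b) = 0"
  by (auto simp: mabinogion_time_def mabinogion_sum_def)

text \<open>With \<open>i = w - 1\<close> and \<open>w < b\<close>, the three values are
  \<open>q\<close> times \<open>G\<close> at \<open>i\<close>, \<open>i + 1\<close>,
  \<open>i + 2\<close>. The equation becomes
  \<open>w * (q * g (i + 1)) = b * (q * g i) - (w + b)\<close>, which is \<open>q\<close> times the
  recursion for \<open>g\<close>: the prefactor \<open>q\<close> turns \<open>2 * (n + 1)\<close>
  into \<open>n + 2 = w + b\<close>.\<close>

lemma mabinogion_time_step_le: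
  assumes "0 < w" "w \<le> b"
  shows "real (w + b) * mabinogion_time (w, b) = real (w + b)
    + real w * mabinogion_time (w + 1, b - 1) + real b * mabinogion_time (w - 1, b + 1)"
proof -
  define n where "n = w + b - 2"
  obtain i where w: "w = Suc i" using assms by (cases w) auto
  define g where "g j = real (Suc n choose j) * inverse_binomial_sum n j" for j
  define G where "G = mabinogion_sum n"
  define q where "q = (real n + 2) / (2 * (real n + 1))"
  have n: "w + b = n + 2" using assms by (simp add: n_def)
  have b: "b = n + 1 - i" "i \<le> n" using n w assms by simp_all
  have rb: "real b = real n + 1 - real i" using b by (simp add: of_nat_diff)
  have G_Suc: "G (Suc j) = G j + g j" for j
    unfolding G_def g_def by (rule mabinogion_sum_Suc_arg)
  have q: "q * (2 * (real n + 1)) = real n + 2" unfolding q_def by simp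
  have t: "mabinogion_time (w, b) = q * G (Suc i)"
    using mabinogion_time_alt[OF n] assms w by (simp add: q_def G_def)
  have t_down: "mabinogion_time (w - 1, b + 1) = q * G i"
    using mabinogion_time_alt[of "w - 1" "b + 1" n] assms n w by (simp add: q_def G_def)
  show ?thesis
  proof (cases "w = b")
    case True
    have n2: "n = 2 * i" using True w b by simp
    \<comment> \<open>From the diagonal both moves lead to mirror images, so it remains to see that
      the increment \<open>q * g i\<close> is 1.\<close>
    have t_up: "mabinogion_time (w + 1, b - 1) = q * G i"
      using True t_down mabinogion_time_swap[of "w + 1" "b - 1"] by simp
    have "g i = (real n + 1) / (real n + 1 - real i)"
      unfolding g_def using inverse_binomial_sum_middle[of i] Suc_choose_over_choose[OF b(2)]
      by (simp add: n2 del: binomial_Suc_Suc)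
    then have "g i = (2 * real i + 1) / (real i + 1)" by (simp add: n2 algebra_simps)
    then have "q * g i = 1"
      unfolding q_def by (simp add: n2 divide_simps) (simp add: algebra_simps)
    then have "q * G (Suc i) = q * G i + 1" by (simp add: G_Suc algebra_simps)
    then show ?thesis unfolding t t_up t_down using True by (simp add: algebra_simps)
  next
    case False
    then have lt: "2 * i < n" using assms w b by simp
    \<comment> \<open>For \<open>b = w + 1\<close> the minimum stays at \<open>Suc i\<close>, but
      the extra increment \<open>g (Suc i)\<close> contains an empty sum and is 0.\<close>
    have "G (min (w + 1) (b - 1)) = G (Suc (Suc i))"
    proof (cases "w + 1 \<le> b - 1")
      case False
      then have "2 * Suc i = Suc n" "b - 1 = Suc i" using lt w b by simp_all
      then show ?thesis using w by (simp add: G_Suc g_def inverse_binomial_sum_eq_0)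
    qed (simp add: w)
    then have t_up: "mabinogion_time (w + 1, b - 1) = q * G (Suc (Suc i))"
      using mabinogion_time_alt[of "w + 1" "b - 1" n] assms n by (simp add: q_def G_def)
    have "real (Suc i) * g (Suc i) = (real n + 1 - real i) * g i - 2 * (real n + 1)"
      unfolding g_def by (rule choose_mult_inverse_binomial_sum_step[OF lt])
    then have "real w * g (Suc i) = real b * g i - 2 * (real n + 1)"
      unfolding w rb by simp
    then have "real w * (q * g (Suc i)) = q * (real b * g i - 2 * (real n + 1))"
      by (metis mult.left_commute)
    also have "\<dots> = real b * (q * g i) - real (w + b)"
      using q n by (simp add: right_diff_distrib mult.left_commute)
    finally have "real w * (q * g (Suc i)) = real b * (q * g i) - real (w + b)" .
    then show ?thesis unfolding t t_up t_down G_Suc by (simp add: algebra_simps)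
  qed
qed

lemma mabinogion_time_step:
  assumes "0 < w" "0 < b"
  shows "real (w + b) * mabinogion_time (w, b) = real (w + b)
    + real w * mabinogion_time (w + 1, b - 1) + real b * mabinogion_time (w - 1, b + 1)"
proof (cases "w \<le> b")
  case False
  then show ?thesis
    using mabinogion_time_step_le[of b w] assms
    by (simp add: mabinogion_time_swap[of w b] mabinogion_time_swap[of "Suc w" "b - Suc 0"]
        mabinogion_time_swap[of "w - Suc 0" "Suc b"] algebra_simps)
qed (rule mabinogion_time_step_le[OF assms(1)])

section \<open>Recursion in the number of balls and the diagonal sum\<close>

lemma sum_shift_diff:
  fixes x :: real
  shows "(\<Sum>i\<le>m. 1 / (x + 1 - real i)) - (\<Sum>i<m. 1 / (x - real i)) = 1 / (x + 1)"
proof -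
  have "x + 1 - real (Suc i) = x - real i" for i by simp
  then show ?thesis
    unfolding lessThan_Suc_atMost[symmetric] sum.lessThan_Suc_shift by simp
qed

text \<open>Expanding the inner sums by \<open>inverse_binomial_sum_Suc\<close> and the binomials by
  Pascal's rule leaves two sums of reciprocals, which by \<open>sum_shift_diff\<close> cancel up to
  \<open>1 / (n + 2)\<close>.\<close>

lemma mabinogion_sum_Suc:
  assumes "2 * m \<le> Suc n"
  shows "mabinogion_sum (Suc n) (Suc m) / (real n + 2) =
    1 / (real n + 2) + (mabinogion_sum n (Suc m) + mabinogion_sum n m) / (2 * (real n + 1))"
proof -
  define a where "a = inverse_binomial_sum n"
  have "mabinogion_sum (Suc n) (Suc m) =
     (\<Sum>i\<le>m. real (Suc (Suc n) choose i) / real (Suc n choose i))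
      + (real n + 2) / (2 * (real n + 1)) * (\<Sum>i\<le>m. real (Suc (Suc n) choose i) * a i)"
    unfolding mabinogion_sum_def lessThan_Suc_atMost sum_distrib_left sum.distrib[symmetric] a_def
    using assms
    by (intro sum.cong refl)
       (simp add: inverse_binomial_sum_Suc algebra_simps del: binomial_Suc_Suc)
  also have "(\<Sum>i\<le>m. real (Suc (Suc n) choose i) / real (Suc n choose i))
      = (real n + 2) * (\<Sum>i\<le>m. 1 / (real n + 2 - real i))"
    unfolding sum_distrib_left
    using assms by (intro sum.cong refl, subst Suc_choose_over_choose) (auto simp: algebra_simps)
  \<comment> \<open>Pascal's rule; reindexing its second part pairs \<open>Suc n choose i\<close>
    with \<open>a (Suc i)\<close>.\<close>
  also have "(\<Sum>i\<le>m. real (Suc (Suc n) choose i) * a i)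
      = mabinogion_sum n (Suc m) + (\<Sum>i<m. real (Suc n choose i) * a (Suc i))"
    unfolding mabinogion_sum_def a_def[symmetric] lessThan_Suc_atMost[symmetric]
    by (simp add: sum.lessThan_Suc_shift algebra_simps sum.distrib del: sum.lessThan_Suc)
  \<comment> \<open>Going back from \<open>a (Suc i)\<close> to \<open>a i\<close> costs twice a
    quotient of binomials from adjacent rows.\<close>
  also have "(\<Sum>i<m. real (Suc n choose i) * a (Suc i))
      = (\<Sum>i<m. real (Suc n choose i) * a i - 2 * (real n + 1) * (1 / (real n + 1 - real i)))"
  proof (rule sum.cong)
    fix i assume "i \<in> {..<m}"
    then have lt: "2 * i < n" using assms by simp
    have "real (Suc n choose i) * a (Suc i)
       = real (Suc n choose i) * a i - 2 * (real (Suc n choose i) / real (n choose i))"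
      unfolding a_def inverse_binomial_sum_shift[OF lt] by (simp add: algebra_simps del: binomial_Suc_Suc)
    then show "real (Suc n choose i) * a (Suc i)
       = real (Suc n choose i) * a i - 2 * (real n + 1) * (1 / (real n + 1 - real i))"
      using lt by (simp add: Suc_choose_over_choose del: binomial_Suc_Suc)
  qed simp
  also have "\<dots> = mabinogion_sum n m - 2 * (real n + 1) * (\<Sum>i<m. 1 / (real n + 1 - real i))"
    by (simp only: sum_subtractf sum_distrib_left mabinogion_sum_def a_def)
  finally have "mabinogion_sum (Suc n) (Suc m) / (real n + 2) =
    (\<Sum>i\<le>m. 1 / (real n + 2 - real i)) - (\<Sum>i<m. 1 / (real n + 1 - real i))
     + (mabinogion_sum n (Suc m) + mabinogion_sum n m) / (2 * (real n + 1))"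
    by (simp add: divide_simps) (simp add: algebra_simps)
  then show ?thesis
    using sum_shift_diff[where m = m and x = "real n + 1"] by (simp add: add.assoc)
qed

text \<open>The step from row \<open>2 * m\<close> to row \<open>2 * m + 1\<close> leaves the
  normalised sum unchanged; the step to row \<open>2 * m + 2\<close> adds
  \<open>1 / (2 * m + 3)\<close>.\<close>

lemma mabinogion_sum_diagonal:
  "mabinogion_sum (2 * m) (Suc m) / (2 * real m + 1) = (\<Sum>i\<le>m. 1 / (2 * real i + 1))"
proof (induction m)
  case 0
  then show ?case by (simp add: mabinogion_sum_def inverse_binomial_sum_def)
next
  case (Suc m)
  \<comment> \<open>Divided by \<open>2 * (2 * m + 1)\<close>, this last increment is the
    \<open>1 / (2 * m + 2)\<close> that \<open>mabinogion_sum_Suc\<close> adds, so the two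
    cancel.\<close>
  have mid: "mabinogion_sum (2 * m) (Suc m)
      = mabinogion_sum (2 * m) m + (2 * real m + 1) / (real m + 1)"
    using Suc_choose_over_choose[of m "2 * m"]
    by (simp add: mabinogion_sum_Suc_arg inverse_binomial_sum_middle del: binomial_Suc_Suc)
  have "mabinogion_sum (Suc (2 * m)) (Suc m) / (2 * real m + 2)
     = 1 / (2 * real m + 2)
       + (mabinogion_sum (2 * m) (Suc m) + mabinogion_sum (2 * m) m) / (2 * (2 * real m + 1))"
    using mabinogion_sum_Suc[of m "2 * m"] by simp
  also have "\<dots> = mabinogion_sum (2 * m) (Suc m) / (2 * real m + 1)"
  proof -
    have "(2 * real m + 1) / (real m + 1) / (2 * (2 * real m + 1)) = 1 / (2 * real m + 2)"
      by (simp add: divide_simps) (simp add: algebra_simps)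
    moreover have "mabinogion_sum (2 * m) (Suc m) / (2 * real m + 1)
        = 2 * mabinogion_sum (2 * m) (Suc m) / (2 * (2 * real m + 1))"
      by (rule mult_divide_mult_cancel_left[symmetric]) simp
    ultimately show ?thesis
      using mid by (simp only: add_divide_distrib mult_2)
  qed
  finally have odd:
    "mabinogion_sum (Suc (2 * m)) (Suc m) / (2 * real m + 2) = (\<Sum>i\<le>m. 1 / (2 * real i + 1))"
    by (simp add: Suc.IH)
  \<comment> \<open>The new inner sum runs from \<open>m + 1\<close> to \<open>m\<close> and is
    empty.\<close>
  have "mabinogion_sum (Suc (2 * m)) (Suc (Suc m)) = mabinogion_sum (Suc (2 * m)) (Suc m)"
    by (simp add: mabinogion_sum_Suc_arg[of _ "Suc m"] inverse_binomial_sum_eq_0)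
  then have "mabinogion_sum (2 * Suc m) (Suc (Suc m)) / (2 * real m + 3)
     = 1 / (2 * real m + 3) + mabinogion_sum (Suc (2 * m)) (Suc m) / (2 * real m + 2)"
    using mabinogion_sum_Suc[of "Suc m" "Suc (2 * m)"]
    by (simp add: divide_simps) (simp add: algebra_simps)
  then show ?case unfolding odd by (simp add: algebra_simps)
qed

section \<open>Expected hitting times of Markov chains\<close>

lemma nn_integral_countable_type:
  fixes Z :: "'a \<Rightarrow> 'z::countable" and F :: "'z \<Rightarrow> ennreal"
  assumes Z: "Z \<in> measurable M (count_space UNIV)"
  shows "(\<integral>\<^sup>+\<omega>. F (Z \<omega>) \<partial>M) = (\<integral>\<^sup>+z. emeasure M {\<omega> \<in> space M. Z \<omega> = z} * F z \<partial>count_space UNIV)"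
proof -
  have eq: "distr M (count_space UNIV) Z
      = density (count_space UNIV) (\<lambda>z. emeasure M {\<omega> \<in> space M. Z \<omega> = z})"
  proof (rule measure_eqI_countable[where A = UNIV])
    fix z
    have "emeasure (distr M (count_space UNIV) Z) {z} = emeasure M (Z -` {z} \<inter> space M)"
      using Z by (rule emeasure_distr) simp
    also have "Z -` {z} \<inter> space M = {\<omega> \<in> space M. Z \<omega> = z}" by auto
    finally show "emeasure (distr M (count_space UNIV) Z) {z} =
       emeasure (density (count_space UNIV) (\<lambda>z. emeasure M {\<omega> \<in> space M. Z \<omega> = z})) {z}"
      by (simp add: emeasure_density)
  qed auto
  have "(\<integral>\<^sup>+\<omega>. F (Z \<omega>) \<partial>M) = (\<integral>\<^sup>+z. F z \<partial>distr M (count_space UNIV) Z)"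
    using Z by (simp add: nn_integral_distr)
  then show ?thesis unfolding eq by (simp add: nn_integral_density)
qed

section \<open>Histories and one-step expectations\<close>

text \<open>\<open>markov_chain\<close> conditions on whole paths. As a list, the path up to time
  \<open>n\<close> lies in a countable type, so expectations over it are sums.\<close>

definition history :: "(nat \<Rightarrow> 'a \<Rightarrow> 's) \<Rightarrow> nat \<Rightarrow> 'a \<Rightarrow> 's list" where
  "history X n \<omega> = map (\<lambda>i. X i \<omega>) [0..<Suc n]"

lemma history_eq_iff:
  "history X n \<omega> = h \<longleftrightarrow> length h = Suc n \<and> (\<forall>i\<le>n. X i \<omega> = h ! i)"
  unfolding history_def
  by (auto simp: list_eq_iff_nth_eq nth_append less_Suc_eq_le simp del: upt_Suc)

lemma nth_history: "i \<le> n \<Longrightarrow> history X n \<omega> ! i = X i \<omega>"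
  unfolding history_def by (simp add: less_Suc_eq_le del: upt_Suc)

locale markov_chain_locale = prob_space M
  for M :: "'a measure" +
  fixes K :: "'s::countable \<Rightarrow> 's pmf" and X :: "nat \<Rightarrow> 'a \<Rightarrow> 's"
  assumes chain: "markov_chain M K X"
begin

lemma measurable_X [measurable]: "X n \<in> measurable M (count_space UNIV)"
  using chain by (simp add: markov_chain_def)

lemma measurable_history [measurable]: "history X n \<in> measurable M (count_space UNIV)"
proof (subst measurable_count_space_eq2_countable, safe)
  fix h :: "'s list"
  have "history X n -` {h} \<inter> space M = {\<omega> \<in> space M. length h = Suc n \<and> (\<forall>i\<le>n. X i \<omega> = h ! i)}"
    using history_eq_iff[of X n _ h] by blast
  then show "history X n -` {h} \<inter> space M \<in> sets M" by simp
qed auto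

text \<open>Product form of the Markov property, without division: for a history of probability 0
  both sides vanish, and for a list of the wrong length both events are empty.\<close>

lemma emeasure_history_step:
  "emeasure M {\<omega> \<in> space M. history X n \<omega> = h \<and> X (Suc n) \<omega> = y}
     = emeasure M {\<omega> \<in> space M. history X n \<omega> = h} * ennreal (pmf (K (h ! n)) y)"
proof (cases "length h = Suc n")
  case True
  then have hist: "history X n \<omega> = h \<longleftrightarrow> (\<forall>i\<le>n. X i \<omega> = h ! i)" for \<omega>
    by (simp add: history_eq_iff)
  let ?A = "{\<omega> \<in> space M. \<forall>i\<le>n. X i \<omega> = h ! i}"
  let ?B = "{\<omega> \<in> space M. (\<forall>i\<le>n. X i \<omega> = h ! i) \<and> X (Suc n) \<omega> = y}"
  have "prob ?B = prob ?A * pmf (K (h ! n)) y"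
  proof (cases "prob ?A > 0")
    case True
    then have "prob {\<omega> \<in> space M. X (Suc n) \<omega> = y \<and> (\<forall>i\<le>n. X i \<omega> = h ! i)} / prob ?A = pmf (K (h ! n)) y"
      using chain unfolding markov_chain_def cond_prob_def by blast
    moreover have "{\<omega> \<in> space M. X (Suc n) \<omega> = y \<and> (\<forall>i\<le>n. X i \<omega> = h ! i)} = ?B" by auto
    ultimately show ?thesis using True by (simp add: field_simps)
  next
    case False
    then have 0: "prob ?A = 0" using measure_nonneg[of M ?A] by linarith
    have "prob ?B \<le> prob ?A" by (rule finite_measure_mono) auto
    then show ?thesis using 0 measure_nonneg[of M ?B] by simp
  qed
  then show ?thesis
    unfolding hist emeasure_eq_measure by (simp add: ennreal_mult)
qed (simp add: history_eq_iff)

text \<open>Sum the product form over all histories and next states. \<open>F\<close> sees the whole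
  past, so it can include survival up to time \<open>n\<close>.\<close>

lemma nn_integral_history_step:
  fixes F :: "'s list \<Rightarrow> 's \<Rightarrow> ennreal"
  shows "(\<integral>\<^sup>+\<omega>. F (history X n \<omega>) (X (Suc n) \<omega>) \<partial>M)
    = (\<integral>\<^sup>+\<omega>. (\<integral>\<^sup>+y. F (history X n \<omega>) y \<partial>K (X n \<omega>)) \<partial>M)"
proof -
  let ?P = "\<lambda>h. emeasure M {\<omega> \<in> space M. history X n \<omega> = h}"
  let ?Z = "\<lambda>\<omega>. (history X n \<omega>, X (Suc n) \<omega>)"
  have "?Z \<in> measurable M (count_space UNIV \<Otimes>\<^sub>M count_space UNIV)" by measurable
  then have Z: "?Z \<in> measurable M (count_space UNIV)"
    by (simp add: pair_measure_countable)
  have "(\<integral>\<^sup>+\<omega>. F (history X n \<omega>) (X (Suc n) \<omega>) \<partial>M) = (\<integral>\<^sup>+\<omega>. (\<lambda>(h, y). F h y) (?Z \<omega>) \<partial>M)"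
    by simp
  also have "\<dots> = (\<integral>\<^sup>+z. emeasure M {\<omega> \<in> space M. ?Z \<omega> = z} * (\<lambda>(h, y). F h y) z \<partial>count_space UNIV)"
    by (rule nn_integral_countable_type[OF Z])
  also have "\<dots> = (\<integral>\<^sup>+z. (\<lambda>(h, y). ?P h * (ennreal (pmf (K (h ! n)) y) * F h y)) z \<partial>count_space UNIV)"
    by (intro nn_integral_cong) (auto simp: emeasure_history_step mult.assoc)
  also have "\<dots> = (\<integral>\<^sup>+h. \<integral>\<^sup>+y. ?P h * (ennreal (pmf (K (h ! n)) y) * F h y) \<partial>count_space UNIV \<partial>count_space UNIV)"
    by (subst nn_integral_fst_count_space[symmetric]) simp
  also have "\<dots> = (\<integral>\<^sup>+h. ?P h * (\<integral>\<^sup>+y. F h y \<partial>K (h ! n)) \<partial>count_space UNIV)"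
    by (simp add: nn_integral_cmult nn_integral_measure_pmf)
  also have "\<dots> = (\<integral>\<^sup>+\<omega>. (\<lambda>h. \<integral>\<^sup>+y. F h y \<partial>K (h ! n)) (history X n \<omega>) \<partial>M)"
    by (rule nn_integral_countable_type[OF measurable_history, symmetric])
  finally show ?thesis by (simp add: nth_history)
qed

text \<open>Apply the one-step formula to the indicator of leaving the support; its inner integral
  is 0.\<close>

lemma AE_successor: "AE \<omega> in M. \<forall>n. X (Suc n) \<omega> \<in> set_pmf (K (X n \<omega>))"
  unfolding AE_all_countable
proof
  fix n
  have "(\<lambda>\<omega>. (X n \<omega>, X (Suc n) \<omega>)) \<in> measurable M (count_space UNIV \<Otimes>\<^sub>M count_space UNIV)"
    by measurable
  then have "(\<lambda>\<omega>. (X n \<omega>, X (Suc n) \<omega>)) \<in> measurable M (count_space UNIV)"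
    by (simp add: pair_measure_countable)
  from measurable_sets[OF this, of "{(x, y). y \<notin> set_pmf (K x)}"]
  have meas: "{\<omega> \<in> space M. X (Suc n) \<omega> \<notin> set_pmf (K (X n \<omega>))} \<in> sets M"
    by (simp add: vimage_def Int_def conj_commute)
  have "emeasure M {\<omega> \<in> space M. X (Suc n) \<omega> \<notin> set_pmf (K (X n \<omega>))}
      = (\<integral>\<^sup>+\<omega>. indicator (- set_pmf (K (history X n \<omega> ! n))) (X (Suc n) \<omega>) \<partial>M)"
    by (subst nn_integral_indicator[OF meas, symmetric], rule nn_integral_cong)
       (simp add: nth_history indicator_def)
  also have "\<dots> = (\<integral>\<^sup>+\<omega>. \<integral>\<^sup>+y. indicator (- set_pmf (K (X n \<omega>))) y \<partial>K (X n \<omega>) \<partial>M)"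
    by (subst nn_integral_history_step) (simp add: nth_history)
  also have "\<dots> = (\<integral>\<^sup>+\<omega>. 0 \<partial>M)"
    by (intro nn_integral_cong, subst nn_integral_0_iff_AE) (auto simp: AE_measure_pmf_iff)
  finally show "AE \<omega> in M. X (Suc n) \<omega> \<in> set_pmf (K (X n \<omega>))"
    using meas by (subst AE_iff_measurable[OF meas]) auto
qed

end

section \<open>Hitting times as sums of survival probabilities\<close>

text \<open>The first hitting time is the number of \<open>n\<close> without a hit up to time
  \<open>n\<close>. If there is no hit, the infimum over the empty set and the series of ones are
  both infinite.\<close>

lemma ennreal_of_enat_INF_eq_suminf:
  "ennreal_of_enat (INF n\<in>{n. P n}. enat n) = (\<Sum>n. if \<forall>i\<le>n. \<not> P i then 1 else 0)"
proof (cases "\<exists>n. P n")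
  case True
  define m where "m = (LEAST n. P n)"
  have m: "P m" and le: "\<And>i. P i \<Longrightarrow> m \<le> i"
    unfolding m_def using True by (auto intro: LeastI_ex Least_le)
  have "(INF n\<in>{n. P n}. enat n) = enat m"
    using m le by (intro antisym INF_lower2[of m] INF_greatest) auto
  moreover have "(\<Sum>n. if \<forall>i\<le>n. \<not> P i then 1 else 0 :: ennreal) = (\<Sum>n<m. if \<forall>i\<le>n. \<not> P i then 1 else 0)"
    using m by (intro suminf_finite) (auto simp: not_less)
  moreover have "\<dots> = (\<Sum>n<m. 1)"
    by (intro sum.cong refl) (use le in force)
  ultimately show ?thesis by simp
next
  case False
  then show ?thesis
    using nn_integral_count_space_nat[of "\<lambda>_. 1"] by (simp add: top_enat_def)
qed


text \<open>Iterating \<open>step\<close>, the partial sums plus \<open>a n\<close> stay equal to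
  \<open>a 0\<close>. Hence the series is finite, its terms tend to 0, and \<open>le\<close> forces
  the remainder \<open>a n\<close> to 0.\<close>

lemma suminf_ennreal_zero_limit:
  fixes p a :: "nat \<Rightarrow> ennreal"
  assumes step: "\<And>n. a n = p n + a (Suc n)"
    and le: "\<And>n. a n \<le> c * p n" and c: "c < \<top>" and a0: "a 0 < \<top>"
  shows "(\<Sum>n. p n) = a 0"
proof -
  have partial: "(\<Sum>k<n. p k) + a n = a 0" for n
    by (induction n) (simp_all add: add.assoc flip: step)
  have "(\<Sum>n. p n) \<le> a 0"
    by (rule suminf_le_const) (simp, metis le_iff_add partial)
  then have fin: "(\<Sum>n. p n) \<noteq> \<top>" using a0 by auto
  have p_fin: "p n < \<top>" for n
    using partial[of "Suc n"] a0 by (metis ennreal_add_eq_top less_top sum.lessThan_Suc)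
  define q where "q n = enn2real (p n)" for n
  have p_eq: "p = (\<lambda>n. ennreal (q n))" using p_fin by (simp add: q_def)
  have "q \<longlonglongrightarrow> 0"
    using fin unfolding p_eq
    by (intro summable_LIMSEQ_zero summable_suminf_not_top) (auto simp: q_def)
  then have "p \<longlonglongrightarrow> 0"
    unfolding p_eq by (metis ennreal_0 tendsto_ennrealI)
  then have "(\<lambda>n. c * p n) \<longlonglongrightarrow> c * 0"
    by (rule ennreal_tendsto_cmult[OF c])
  then have "a \<longlonglongrightarrow> 0"
    by (intro tendsto_sandwich[OF _ _ tendsto_const, of 0 a _ "\<lambda>n. c * p n"]) (auto simp: le)
  then have "(\<lambda>n. (\<Sum>k<n. p k) + a n) \<longlonglongrightarrow> (\<Sum>n. p n) + 0"
    by (intro tendsto_add summable_LIMSEQ) auto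
  then show ?thesis unfolding partial by (simp add: LIMSEQ_const_iff)
qed

context markov_chain_locale
begin

text \<open>The closed set \<open>C\<close> confines the chain started in \<open>s\<close>, and its
  finiteness bounds \<open>f\<close> there. The indicator of the start stands in for
  conditioning.\<close>

lemma nn_integral_hitting_time:
  fixes f :: "'s \<Rightarrow> ennreal"
  assumes C: "finite C" "s \<in> C" "\<And>x. x \<in> C \<Longrightarrow> set_pmf (K x) \<subseteq> C"
    and fin: "\<And>x. x \<in> C \<Longrightarrow> f x < \<top>"
    and target: "\<And>x. x \<in> C \<inter> D \<Longrightarrow> f x = 0"
    and step: "\<And>x. x \<in> C - D \<Longrightarrow> f x = 1 + (\<integral>\<^sup>+y. f y \<partial>K x)"
  shows "(\<integral>\<^sup>+\<omega>. ennreal_of_enat (INF n\<in>{n. X n \<omega> \<in> D}. enat n)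
      * indicator {\<omega> \<in> space M. X 0 \<omega> = s} \<omega> \<partial>M) = f s * emeasure M {\<omega> \<in> space M. X 0 \<omega> = s}"
proof -
  \<comment> \<open>\<open>alive n\<close> tests times before \<open>n\<close> only, so
    \<open>p n\<close> is the probability of starting in \<open>s\<close> and avoiding
    \<open>D\<close> up to and including time \<open>n\<close>.\<close>
  define alive :: "nat \<Rightarrow> 's list \<Rightarrow> ennreal"
    where "alive n h = (if h ! 0 = s \<and> (\<forall>i<n. h ! i \<notin> D) then 1 else 0)" for n h
  have alive_Suc: "alive (Suc n) h = (if h ! n \<in> D then 0 else alive n h)" for n h
    by (auto simp: alive_def less_Suc_eq)
  define p where "p n = (\<integral>\<^sup>+\<omega>. alive (Suc n) (history X n \<omega>) \<partial>M)" for n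
  define a where "a n = (\<integral>\<^sup>+\<omega>. alive n (history X n \<omega>) * f (X n \<omega>) \<partial>M)" for n
  have meas: "(\<lambda>\<omega>. g (history X n \<omega>)) \<in> borel_measurable M" for g :: "'s list \<Rightarrow> ennreal" and n
    by (rule measurable_compose[OF measurable_history]) simp
  have in_C: "AE \<omega> in M. X 0 \<omega> = s \<longrightarrow> (\<forall>n. X n \<omega> \<in> C)"
  proof (rule AE_mp[OF AE_successor], rule AE_I2, intro impI allI)
    fix \<omega> n assume "\<forall>n. X (Suc n) \<omega> \<in> set_pmf (K (X n \<omega>))" "X 0 \<omega> = s"
    then show "X n \<omega> \<in> C" using C by (induction n) auto
  qed
  \<comment> \<open>Since \<open>f\<close> vanishes on \<open>D\<close>, survival may be demanded at
    time \<open>n\<close> too; then \<open>step\<close> applies at \<open>X n\<close>.\<close>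
  have a_alive: "a n = (\<integral>\<^sup>+\<omega>. alive (Suc n) (history X n \<omega>) * f (X n \<omega>) \<partial>M)" for n
    unfolding a_def using in_C
    by (intro nn_integral_cong_AE, eventually_elim)
       (auto simp: alive_Suc nth_history target, simp add: alive_def nth_history)
  have a_step: "a n = p n + a (Suc n)" for n
  proof -
    have "a n = (\<integral>\<^sup>+\<omega>. alive (Suc n) (history X n \<omega>)
        + alive (Suc n) (history X n \<omega>) * (\<integral>\<^sup>+y. f y \<partial>K (history X n \<omega> ! n)) \<partial>M)"
      unfolding a_alive using in_C
      by (intro nn_integral_cong_AE, eventually_elim)
         (auto simp: alive_def nth_history step)
    also have "\<dots> = p n + (\<integral>\<^sup>+\<omega>. alive (Suc n) (history X n \<omega>) * (\<integral>\<^sup>+y. f y \<partial>K (history X n \<omega> ! n)) \<partial>M)"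
      unfolding p_def by (intro nn_integral_add meas)
    also have "(\<integral>\<^sup>+\<omega>. alive (Suc n) (history X n \<omega>) * (\<integral>\<^sup>+y. f y \<partial>K (history X n \<omega> ! n)) \<partial>M)
        = (\<integral>\<^sup>+\<omega>. (\<integral>\<^sup>+y. alive (Suc n) (history X n \<omega>) * f y \<partial>K (X n \<omega>)) \<partial>M)"
      by (simp add: nn_integral_cmult nth_history)
    also have "\<dots> = (\<integral>\<^sup>+\<omega>. alive (Suc n) (history X n \<omega>) * f (X (Suc n) \<omega>) \<partial>M)"
      by (rule nn_integral_history_step[symmetric])
    \<comment> \<open>\<open>alive (Suc n)\<close> reads only entries up to \<open>n\<close>, on
      which the histories up to \<open>n\<close> and \<open>n + 1\<close> agree.\<close>
    also have "\<dots> = a (Suc n)"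
      unfolding a_def by (simp add: alive_def nth_history)
    finally show ?thesis .
  qed
  \<comment> \<open>A crude finite upper bound for \<open>f\<close> on \<open>C\<close>.\<close>
  define c where "c = (\<Sum>x\<in>C. f x)"
  have f_le: "f x \<le> c" if "x \<in> C" for x
    unfolding c_def using that C(1) by (intro member_le_sum) auto
  have "a n \<le> (\<integral>\<^sup>+\<omega>. c * alive (Suc n) (history X n \<omega>) \<partial>M)" for n
    unfolding a_alive using in_C
    by (intro nn_integral_mono_AE, eventually_elim) (auto simp: alive_def nth_history f_le)
  then have a_le: "a n \<le> c * p n" for n
    unfolding p_def by (simp add: nn_integral_cmult meas)
  have "a 0 = (\<integral>\<^sup>+\<omega>. f s * indicator {\<omega> \<in> space M. X 0 \<omega> = s} \<omega> \<partial>M)"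
    unfolding a_def by (intro nn_integral_cong) (simp add: alive_def nth_history)
  also have "\<dots> = f s * emeasure M {\<omega> \<in> space M. X 0 \<omega> = s}"
    by (simp add: nn_integral_cmult)
  finally have a0: "a 0 = f s * emeasure M {\<omega> \<in> space M. X 0 \<omega> = s}" .
  have "(\<integral>\<^sup>+\<omega>. ennreal_of_enat (INF n\<in>{n. X n \<omega> \<in> D}. enat n)
      * indicator {\<omega> \<in> space M. X 0 \<omega> = s} \<omega> \<partial>M)
      = (\<integral>\<^sup>+\<omega>. (\<Sum>n. alive (Suc n) (history X n \<omega>)) \<partial>M)"
    unfolding ennreal_of_enat_INF_eq_suminf
    by (intro nn_integral_cong, case_tac "X 0 x = s")
       (auto simp: alive_def nth_history less_Suc_eq_le intro!: suminf_cong)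
  also have "\<dots> = (\<Sum>n. p n)"
    unfolding p_def by (intro nn_integral_suminf meas)
  also have "\<dots> = a 0"
    using a_step a_le
    by (rule suminf_ennreal_zero_limit)
       (use C fin in \<open>auto simp: c_def a0 ennreal_mult_less_top emeasure_eq_measure\<close>)
  finally show ?thesis unfolding a0 .
qed

lemma expected_hitting_time:
  fixes f :: "'s \<Rightarrow> ennreal"
  assumes "finite C" "s \<in> C" "\<And>x. x \<in> C \<Longrightarrow> set_pmf (K x) \<subseteq> C"
    and "\<And>x. x \<in> C \<Longrightarrow> f x < \<top>"
    and "\<And>x. x \<in> C \<inter> D \<Longrightarrow> f x = 0"
    and "\<And>x. x \<in> C - D \<Longrightarrow> f x = 1 + (\<integral>\<^sup>+y. f y \<partial>K x)"
    and pos: "\<P>(\<omega> in M. X 0 \<omega> = s) > 0"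
  shows "(\<integral>\<^sup>+\<omega>. ennreal_of_enat (INF n\<in>{n. X n \<omega> \<in> D}. enat n)
      \<partial>uniform_measure M {\<omega> \<in> space M. X 0 \<omega> = s}) = f s"
proof -
  have "(\<lambda>\<omega>. ennreal_of_enat (INF n\<in>{n. X n \<omega> \<in> D}. enat n)) \<in> borel_measurable M"
    unfolding ennreal_of_enat_INF_eq_suminf by measurable
  then show ?thesis
    using pos nn_integral_hitting_time[OF assms(1-6)]
    by (simp add: nn_integral_uniform_measure emeasure_eq_measure ennreal_mult_divide_eq)
qed

end

section \<open>The Mabinogion urn\<close>

lemma nn_integral_mabinogion_kernel:
  assumes "0 < w" "0 < b"
  shows "(\<integral>\<^sup>+y. ennreal (mabinogion_time y) \<partial>mabinogion_kernel (w, b))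
    = ennreal (real w / real (w + b) * mabinogion_time (w + 1, b - 1)
        + real b / real (w + b) * mabinogion_time (w - 1, b + 1))"
proof -
  have "1 - real w / real (w + b) = real b / real (w + b)"
    using assms by (simp add: field_simps)
  moreover have "0 \<le> real w / real (w + b)" "real w / real (w + b) \<le> 1"
    using assms by simp_all
  ultimately show ?thesis
    using assms mabinogion_time_nonneg
    by (simp add: mabinogion_kernel_def mult.commute flip: ennreal_mult' ennreal_plus del: of_nat_add)
qed

lemma expected_absorption_time_eq:
  assumes "mabinogion M W B" and pos: "\<P>(\<omega> in M. W 0 \<omega> = w \<and> B 0 \<omega> = b) > 0"
  shows "expected_absorption_time M W B w b = ennreal (mabinogion_time (w, b))"
proof -
  let ?X = "\<lambda>n \<omega>. (W n \<omega>, B n \<omega>)"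
  have chain: "markov_chain M mabinogion_kernel ?X"
    using assms by (simp add: mabinogion_def)
  interpret prob_space M using chain by (simp add: markov_chain_def)
  interpret markov_chain_locale M mabinogion_kernel ?X by unfold_locales (rule chain)
  \<comment> \<open>Every transition preserves the number of balls, so this finite set is
    closed.\<close>
  define C where "C = {(w', b'). w' + b' = w + b}"
  define D :: "(nat \<times> nat) set" where "D = {(w', b'). w' = 0 \<or> b' = 0}"
  have "finite C"
    by (rule finite_subset[of _ "{..w + b} \<times> {..w + b}"]) (auto simp: C_def)
  moreover have "(w, b) \<in> C" by (simp add: C_def)
  moreover have "set_pmf (mabinogion_kernel x) \<subseteq> C" if "x \<in> C" for x
    using that by (auto simp: C_def mabinogion_kernel_def split: if_splits)
  moreover have "ennreal (mabinogion_time x) = 0" if "x \<in> C \<inter> D" for x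
    using that by (auto simp: D_def mabinogion_time_eq_0)
  moreover have "ennreal (mabinogion_time x) = 1 + (\<integral>\<^sup>+y. ennreal (mabinogion_time y) \<partial>mabinogion_kernel x)"
    if "x \<in> C - D" for x
  proof -
    obtain u v where x: "x = (u, v)" by (cases x)
    then have uv: "0 < u" "0 < v" using that by (auto simp: D_def)
    let ?r = "real u / real (u + v) * mabinogion_time (u + 1, v - 1)
        + real v / real (u + v) * mabinogion_time (u - 1, v + 1)"
    \<comment> \<open>Dividing \<open>mabinogion_time_step\<close> by the number of balls gives the
      one-step equation with transition probabilities.\<close>
    have "real (u + v) \<noteq> 0" using uv by simp
    with mabinogion_time_step[OF uv] have "mabinogion_time (u, v) = (real (u + v)
        + real u * mabinogion_time (u + 1, v - 1) + real v * mabinogion_time (u - 1, v + 1)) / real (u + v)"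
      by (metis nonzero_mult_div_cancel_left)
    then have "mabinogion_time x = 1 + ?r"
      using uv by (simp add: x add_divide_distrib del: of_nat_add)
    moreover have "?r \<ge> 0" by (simp add: mabinogion_time_nonneg)
    ultimately show ?thesis
      unfolding x nn_integral_mabinogion_kernel[OF uv] by (metis ennreal_1 ennreal_plus zero_le_one)
  qed
  ultimately have "(\<integral>\<^sup>+\<omega>. ennreal_of_enat (INF n\<in>{n. ?X n \<omega> \<in> D}. enat n)
      \<partial>uniform_measure M {\<omega> \<in> space M. ?X 0 \<omega> = (w, b)}) = ennreal (mabinogion_time (w, b))"
    using pos by (intro expected_hitting_time[where C = C]) auto
  then show ?thesis
    by (simp add: expected_absorption_time_def absorption_time_def D_def)
qed

lemma mabinogion_time_formula:
  assumes "w \<ge> 1" "b \<ge> 1"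
  shows "mabinogion_time (w, b) = real (w + b) / (2 * (real (w + b) - 1)) *
    (\<Sum>i = 0..min w b - 1. \<Sum>j = i..w + b - 2 - i.
       real ((w + b - 1) choose i) / real ((w + b - 2) choose j))"
proof -
  have "{..<min w b} = {0..min w b - 1}" "w + b - 1 = Suc (w + b - 2)" using assms by auto
  then show ?thesis
    by (simp add: mabinogion_time_def mabinogion_sum_def inverse_binomial_sum_def sum_distrib_left
        del: binomial_Suc_Suc)
qed

lemma mabinogion_time_diagonal:
  assumes "k \<ge> 1"
  shows "mabinogion_time (k, k) = real k * (\<Sum>i = 0..k - 1. 1 / (2 * real i + 1))"
proof -
  obtain m where k: "k = Suc m" using assms by (cases k) auto
  \<comment> \<open>With \<open>k = m + 1\<close> there are \<open>2 * m + 2\<close> balls, hence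
    row \<open>2 * m\<close>.\<close>
  have "mabinogion_time (k, k)
      = (2 * real m + 2) / (2 * (2 * real m + 1)) * mabinogion_sum (2 * m) (Suc m)"
    using mabinogion_time_alt[of k k "2 * m"] by (simp add: k)
  also have "\<dots> = (real m + 1) * (mabinogion_sum (2 * m) (Suc m) / (2 * real m + 1))"
    by (simp add: divide_simps) (simp add: algebra_simps)
  finally show ?thesis
    unfolding mabinogion_sum_diagonal by (simp add: k atMost_atLeast0 add.commute)
qed

theorem proposition2p2:
  fixes M :: "'a measure" and W B :: "nat \<Rightarrow> 'a \<Rightarrow> nat"
  assumes "mabinogion M W B"
  shows "(\<forall>w\<ge>1. \<forall>b\<ge>1. \<P>(\<omega> in M. W 0 \<omega> = w \<and> B 0 \<omega> = b) > 0 \<longrightarrow>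
            expected_absorption_time M W B w b =
              ennreal (real (w + b) / (2 * (real (w + b) - 1)) *
                (\<Sum>i = 0..min w b - 1. \<Sum>j = i..w + b - 2 - i.
                   real ((w + b - 1) choose i) / real ((w + b - 2) choose j)))) \<and>
         (\<forall>k\<ge>1. \<P>(\<omega> in M. W 0 \<omega> = k \<and> B 0 \<omega> = k) > 0 \<longrightarrow>
            expected_absorption_time M W B k k =
              ennreal (real k * (\<Sum>i = 0..k - 1. 1 / (2 * real i + 1))))"
proof (intro conjI allI impI, goal_cases)
  case (1 w b)
  then show ?case
    using expected_absorption_time_eq[OF assms, of w b] by (simp only: mabinogion_time_formula)
next
  case (2 k)
  then show ?case
    using expected_absorption_time_eq[OF assms, of k k] by (simp only: mabinogion_time_diagonal)
qed

end
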